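(* Let $M>0$ and let $f=h+\overline{g}\in\mathcal{B}_H^M$. Then $f$ is close-to-convex (in particular univalent) in the disk $|z|<r_S$, where $$r_S=1-\sqrt{\frac{4M}{4M+\pi}},$$ and $f(\{z:|z|<r_S\})$ contains a univalent disk of radius at least $$R_S=r_S-\frac{4M}{\pi}\,\frac{r_S^2}{1-r_S}.$$
   Context: $\mathbb{D}=\{z\in\mathbb{C}:|z|<1\}$. $\mathcal{B}_H^M$ is the class of complex-valued harmonic functions $f=h+\overline{g}$ on $\mathbb{D}$ ($h,g$ analytic in $\mathbb{D}$) with $f(0)=f_{\overline z}(0)=f_z(0)-1=0$ and $|f(z)|<M$ for all $z\in\mathbb{D}$. A domain $\Omega\subset\mathbb{C}$ is close-to-convex if $\mathbb{C}\setminus\Omega$ is a union of closed half-lines whose interiors (open half-lines) are pairwise disjoint. A harmonic function is close-to-convex in a disk $|z|<r$ if it is univalent (injective) and sense-preserving there and maps that disk onto a close-to-convex domain. A univalent disk in $f(U)$ is an open disk that is the image under $f$ of a subdomain of $U$ on which $f$ is injective. *)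

theory Defs
  imports "HOL-Complex_Analysis.Complex_Analysis"
begin

definition wirtinger_z :: "(complex \<Rightarrow> complex) \<Rightarrow> complex \<Rightarrow> complex" where
  "wirtinger_z f z =
     (frechet_derivative f (at z) 1 - \<i> * frechet_derivative f (at z) \<i>) / 2"

definition wirtinger_zbar :: "(complex \<Rightarrow> complex) \<Rightarrow> complex \<Rightarrow> complex" where
  "wirtinger_zbar f z =
     (frechet_derivative f (at z) 1 + \<i> * frechet_derivative f (at z) \<i>) / 2"

definition bounded_harmonic_class :: "real \<Rightarrow> (complex \<Rightarrow> complex) set" where
  "bounded_harmonic_class M =
     {f. (\<exists>h g. h holomorphic_on ball 0 1 \<and> g holomorphic_on ball 0 1 \<and>
                (\<forall>z\<in>ball 0 1. f z = h z + cnj (g z))) \<and>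
         f 0 = 0 \<and> wirtinger_zbar f 0 = 0 \<and> wirtinger_z f 0 - 1 = 0 \<and>
         (\<forall>z\<in>ball 0 1. norm (f z) < M)}"

definition plane_domain :: "complex set \<Rightarrow> bool" where
  "plane_domain S \<longleftrightarrow> open S \<and> connected S \<and> S \<noteq> {}"

definition closed_half_line :: "complex \<Rightarrow> complex \<Rightarrow> complex set" where
  "closed_half_line a u = {a + of_real t * u |t. t \<ge> 0}"

definition open_half_line :: "complex \<Rightarrow> complex \<Rightarrow> complex set" where
  "open_half_line a u = {a + of_real t * u |t. t > 0}"

text \<open>Half-lines are indexed by endpoint and unit direction, so that distinct indices are
  distinct half-lines. The empty family is allowed: the whole plane is close-to-convex.\<close>

definition close_to_convex_domain :: "complex set \<Rightarrow> bool" where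
  "close_to_convex_domain S \<longleftrightarrow>
     plane_domain S \<and>
     (\<exists>L \<subseteq> UNIV \<times> sphere 0 1.
        - S = (\<Union>(a, u)\<in>L. closed_half_line a u) \<and>
        disjoint_family_on (\<lambda>(a, u). open_half_line a u) L)"

text \<open>The difference below is the real Jacobian determinant of \<open>f\<close>.\<close>

definition sense_preserving_on :: "(complex \<Rightarrow> complex) \<Rightarrow> complex set \<Rightarrow> bool" where
  "sense_preserving_on f U \<longleftrightarrow>
     (\<forall>z\<in>U. f differentiable (at z) \<and>
            (norm (wirtinger_z f z))\<^sup>2 - (norm (wirtinger_zbar f z))\<^sup>2 > 0)"

definition close_to_convex_in_disk :: "(complex \<Rightarrow> complex) \<Rightarrow> real \<Rightarrow> bool" where
  "close_to_convex_in_disk f r \<longleftrightarrow>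
     inj_on f (ball 0 r) \<and> sense_preserving_on f (ball 0 r) \<and>
     close_to_convex_domain (f ` ball 0 r)"

definition univalent_disk :: "(complex \<Rightarrow> complex) \<Rightarrow> complex set \<Rightarrow> complex \<Rightarrow> real \<Rightarrow> bool" where
  "univalent_disk f U c \<rho> \<longleftrightarrow>
     \<rho> > 0 \<and> (\<exists>W \<subseteq> U. plane_domain W \<and> inj_on f W \<and> f ` W = ball c \<rho>)"

end

theory Submission
  imports Defs
begin

text \<open>
  Write \<open>f = id + u\<close> and \<open>k = 4 M / \<pi>\<close>. The whole proof rests on the fact that the
  displacement \<open>u\<close> strictly decreases distances on the closed disk of radius \<open>r\<^sub>S\<close>.

  This comes from the coefficient bound \<open>|a\<^sub>n| + |b\<^sub>n| \<le> k\<close> for \<open>n \<ge> 1\<close>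
  (\<open>harmonic_coefficient_bound\<close>). A rotation of the range reduces it to an analytic \<open>H\<close>
  with \<open>|Re H| < M\<close>; averaging \<open>H\<close> over the \<open>n\<close>-th roots of unity turns its \<open>n\<close>-th
  coefficient into the first one of another function with values in the same strip; and there it
  is the Schwarz lemma, since \<open>tan\<close> maps the strip \<open>|Re w| < \<pi> / 4\<close> into the unit disk.
  Summing \<open>|x\<^sup>n - y\<^sup>n| \<le> n r\<^sup>n\<^sup>-\<^sup>1 |x - y|\<close> against these bounds gives the Lipschitz
  constant \<open>k (1 / (1 - r)\<^sup>2 - 1)\<close> for \<open>u\<close>, and \<open>r\<^sub>S\<close> is the radius at which it
  equals 1; the inequality is still strict because the quadratic term is
  (\<open>displacement_shrinks\<close>).

  Close-to-convexity is then geometric. Let \<open>P\<close> be the nearest-point retraction onto the closed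
  disk and extend \<open>f\<close> to the plane by \<open>F z = z + u (P z)\<close>. As \<open>P\<close> does not increase
  distances, \<open>u \<circ> P\<close> strictly decreases those between points that \<open>P\<close> separates, so
  \<open>F\<close> is injective; by Brouwer it is surjective. Outside the disk, \<open>F\<close> translates each
  radial ray, so the complement of the image of the disk is a disjoint union of half-lines
  starting at \<open>f (r\<^sub>S v)\<close> in direction \<open>v\<close>. Finally \<open>|F z| \<ge> r\<^sub>S - |u (P z)| \<ge> R\<^sub>S\<close>
  for \<open>z\<close> outside the disk, so the surjective \<open>F\<close> must attain every value of modulus below
  \<open>R\<^sub>S\<close> inside it.
\<close>

section \<open>Distance-decreasing perturbations of the identity on a disk\<close>

lemma closest_point_cball_ray:
  fixes v :: complex
  assumes "0 \<le> r" "r \<le> s" "norm v = 1"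
  shows "closest_point (cball 0 r) (of_real s * v) = of_real r * v"
proof (rule closest_point_unique[symmetric])
  have "of_real s * v - of_real r * v = of_real (s - r) * v"
    by (simp add: algebra_simps)
  hence "dist (of_real s * v) (of_real r * v) = s - r"
    using assms by (simp only: dist_norm norm_mult norm_of_real) simp
  moreover have "s - r \<le> dist (of_real s * v) z" if "z \<in> cball 0 r" for z
    using that assms norm_triangle_ineq2[of "of_real s * v" z]
    by (simp add: dist_norm norm_mult)
  ultimately show "\<forall>z\<in>cball 0 r. dist (of_real s * v) (of_real r * v) \<le> dist (of_real s * v) z"
    by simp
qed (use assms in \<open>auto simp: norm_mult\<close>)

locale shrinking_perturbation =
  fixes u :: "complex \<Rightarrow> complex" and r :: real
  assumes r_pos: "0 < r"
    and shrink: "\<And>x y. \<lbrakk>x \<in> cball 0 r; y \<in> cball 0 r; x \<noteq> y\<rbrakk> \<Longrightarrow> norm (u x - u y) < norm (x - y)"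
begin

abbreviation retr :: "complex \<Rightarrow> complex" where
  "retr \<equiv> closest_point (cball 0 r)"

text \<open>Agrees with \<open>id + u\<close> on the disk and moves each radial ray outside it by one fixed
  vector, the value of \<open>u\<close> at the point where the ray leaves the disk.\<close>

definition ext :: "complex \<Rightarrow> complex" where
  "ext z = z + u (retr z)"

lemma retr_in: "retr z \<in> cball 0 r"
  using r_pos by (intro closest_point_in_set) auto

lemma retr_eq: "z \<in> cball 0 r \<Longrightarrow> retr z = z"
  by (rule closest_point_self)

lemma retr_nonexpansive: "norm (retr x - retr y) \<le> norm (x - y)"
  using closest_point_lipschitz[of "cball 0 r" x y] r_pos by (simp add: dist_norm)

lemma ext_eq: "z \<in> cball 0 r \<Longrightarrow> ext z = z + u z"
  by (simp add: ext_def retr_eq)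

lemma ext_ray:
  assumes "norm v = 1" "r \<le> s"
  shows "ext (of_real s * v) = ext (of_real r * v) + of_real (s - r) * v"
  using assms r_pos closest_point_cball_ray[of r s v] closest_point_cball_ray[of r r v]
  by (simp add: ext_def algebra_simps)

lemma shrink_le:
  "x \<in> cball 0 r \<Longrightarrow> y \<in> cball 0 r \<Longrightarrow> norm (u x - u y) \<le> norm (x - y)"
  using shrink[of x y] by (cases "x = y") auto

lemma continuous_u: "continuous_on (cball 0 r) u"
  by (rule continuous_onI, rule exI, rule conjI, assumption)
     (use shrink_le in \<open>fastforce simp: dist_norm\<close>)

lemma continuous_ext: "continuous_on UNIV ext"
proof -
  have "continuous_on UNIV retr"
    using r_pos by (intro continuous_on_closest_point) auto
  hence "continuous_on UNIV (\<lambda>z. u (retr z))"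
    by (rule continuous_on_compose2[OF continuous_u]) (use retr_in in auto)
  thus ?thesis
    unfolding ext_def[abs_def] by (intro continuous_intros)
qed

text \<open>If two points had the same image, \<open>u\<close> would preserve the distance of their retractions,
  which \<open>shrink\<close> forbids unless the retractions, and with them the points, coincide.\<close>

lemma inj_ext: "inj ext"
proof (rule injI, rule ccontr)
  fix x y assume eq: "ext x = ext y" and "x \<noteq> y"
  have "x - y = u (retr y) - u (retr x)"
    using eq by (simp add: ext_def algebra_simps)
  hence *: "norm (x - y) = norm (u (retr x) - u (retr y))"
    by (simp add: norm_minus_commute)
  have "retr x \<noteq> retr y"
    using * \<open>x \<noteq> y\<close> by auto
  hence "norm (x - y) < norm (retr x - retr y)"
    unfolding * by (intro shrink retr_in)
  with retr_nonexpansive[of x y] show False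
    by simp
qed

text \<open>\<open>ext - id\<close> is continuous and bounded by some \<open>B\<close>, so \<open>z \<mapsto> w - (ext z - z)\<close> maps the
  closed disk of radius \<open>B\<close> around \<open>w\<close> into itself, and a Brouwer fixed point is a preimage
  of \<open>w\<close>.\<close>

lemma surj_ext: "\<exists>z. ext z = w"
proof -
  have "compact (u ` cball 0 r)"
    by (intro compact_continuous_image continuous_u compact_cball)
  then obtain B where B: "\<And>z. z \<in> cball 0 r \<Longrightarrow> norm (u z) \<le> B" 
    using compact_imp_bounded[of "u ` cball 0 r"] unfolding bounded_iff by blast
  have "B \<ge> 0"
    using B[of 0] r_pos norm_ge_zero[of "u 0"] by (simp del: norm_ge_zero)
  have "continuous_on (cball w B) (\<lambda>z. w - (ext z - z))"
    by (intro continuous_intros continuous_on_subset[OF continuous_ext]) auto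
  then obtain z where "w - (ext z - z) = z"
    using brouwer[of "cball w B" "\<lambda>z. w - (ext z - z)"] B[OF retr_in] \<open>B \<ge> 0\<close>
    by (auto simp: ext_def dist_norm)
  thus ?thesis
    by (intro exI[of _ z]) (simp add: algebra_simps)
qed

lemma image_domain: "plane_domain (ext ` ball 0 r)"
  unfolding plane_domain_def using r_pos
  by (intro conjI invariance_of_domain connected_continuous_image
        continuous_on_subset[OF continuous_ext] inj_on_subset[OF inj_ext]) auto

text \<open>As \<open>ext\<close> is a bijection of the plane, the complement of the image of the disk is the image
  of its exterior, and by \<open>ext_ray\<close> the radial rays that fill the exterior go to half-lines.\<close>

lemma close_to_convex_image: "close_to_convex_domain (ext ` ball 0 r)"
proof -
  define L where "L = (\<lambda>v. (ext (of_real r * v), v)) ` sphere 0 1"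
  have eqI: "s = t \<and> v = v'"
    if "norm v = 1" "norm v' = 1" "s > 0" "t > 0" "ext (of_real s * v) = ext (of_real t * v')"
    for s t :: real and v v' :: complex
  proof -
    have *: "of_real s * v = of_real t * v'"
      using that(5) inj_ext by (auto dest: injD)
    hence "norm (of_real s * v) = norm (of_real t * v')" by simp
    hence "s = t" using that by (simp add: norm_mult)
    thus ?thesis using * that by simp
  qed
  have "- (ext ` ball 0 r) = (\<Union>(a, v)\<in>L. closed_half_line a v)"
  proof (intro equalityI subsetI)
    fix w assume w: "w \<in> - (ext ` ball 0 r)"
    obtain z where z: "ext z = w" using surj_ext by blast
    with w have "norm z \<ge> r" by (force simp: not_less)
    define v where "v = z / of_real (norm z)"
    have v: "norm v = 1" "z = of_real (norm z) * v"
      using \<open>norm z \<ge> r\<close> r_pos by (auto simp: v_def norm_divide)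
    have "w = ext (of_real r * v) + of_real (norm z - r) * v"
      using ext_ray[OF v(1) \<open>norm z \<ge> r\<close>] v(2) z by simp
    hence "w \<in> closed_half_line (ext (of_real r * v)) v"
      unfolding closed_half_line_def using \<open>norm z \<ge> r\<close>
      by (intro CollectI exI[of _ "norm z - r"]) auto
    thus "w \<in> (\<Union>(a, v)\<in>L. closed_half_line a v)"
      using v(1) by (auto simp: L_def)
  next
    fix w assume "w \<in> (\<Union>(a, v)\<in>L. closed_half_line a v)"
    then obtain v t where vt: "norm v = 1" "t \<ge> 0" "w = ext (of_real r * v) + of_real t * v"
      by (auto simp: L_def closed_half_line_def)
    have w: "w = ext (of_real (r + t) * v)"
      using ext_ray[of v "r + t"] vt by simp
    have "norm z \<ge> r" if "ext z = w" for z
    proof -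
      have "z = of_real (r + t) * v"
        using that w inj_ext by (auto dest: injD)
      thus ?thesis using vt r_pos by (simp add: norm_mult flip: of_real_add)
    qed
    thus "w \<in> - (ext ` ball 0 r)" by force
  qed
  moreover have "disjoint_family_on (\<lambda>(a, v). open_half_line a v) L"
    unfolding disjoint_family_on_def
  proof (intro ballI impI)
    fix p q assume "p \<in> L" "q \<in> L" "p \<noteq> q"
    then obtain v v' where v: "norm v = 1" "norm v' = 1"
      "p = (ext (of_real r * v), v)" "q = (ext (of_real r * v'), v')"
      by (auto simp: L_def)
    have "v \<noteq> v'" using \<open>p \<noteq> q\<close> v by auto
    have False if "s > 0" "t > 0"
      "ext (of_real r * v) + of_real s * v = ext (of_real r * v') + of_real t * v'" for s t
      using that v \<open>v \<noteq> v'\<close> eqI[of v v' "r + s" "r + t"] r_pos ext_ray[of v "r + s"] ext_ray[of v' "r + t"]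
      by simp
    thus "(case p of (a, v) \<Rightarrow> open_half_line a v) \<inter> (case q of (a, v) \<Rightarrow> open_half_line a v) = {}"
      unfolding v open_half_line_def by auto
  qed
  moreover have "L \<subseteq> UNIV \<times> sphere 0 1" by (auto simp: L_def)
  ultimately show ?thesis
    unfolding close_to_convex_domain_def using image_domain by blast
qed

text \<open>Points outside the open disk go to points of modulus at least \<open>R\<close>, so by surjectivity
  smaller values are attained inside.\<close>

lemma univalent_disk_image:
  assumes "0 < R" and bound: "\<And>z. z \<in> cball 0 r \<Longrightarrow> norm (u z) \<le> r - R"
  shows "univalent_disk ext (ball 0 r) 0 R"
proof -
  obtain g where g: "homeomorphism (ball 0 r) (ext ` ball 0 r) ext g"
    using invariance_of_domain_homeomorphism[of "ball 0 r" ext]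
      continuous_on_subset[OF continuous_ext] inj_on_subset[OF inj_ext] by auto
  have sub: "ball 0 R \<subseteq> ext ` ball 0 r"
  proof
    fix w :: complex assume w: "w \<in> ball 0 R"
    obtain z where z: "ext z = w" using surj_ext by blast
    have "norm z < r"
    proof (rule ccontr)
      assume "\<not> norm z < r"
      moreover have "norm z - norm (u (retr z)) \<le> norm w"
        using norm_diff_ineq[of z "u (retr z)"] z by (simp add: ext_def)
      ultimately show False using bound[OF retr_in, of z] w by simp
    qed
    thus "w \<in> ext ` ball 0 r" using z by auto
  qed
  let ?W = "g ` ball 0 R"
  have gW: "?W \<subseteq> ball 0 r"
    using g sub by (force simp: homeomorphism_def)
  have extW: "ext ` ?W = ball 0 R"
    using g sub by (force simp: homeomorphism_def image_image)
  have cont_g: "continuous_on (ball 0 R) g"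
    using g sub by (auto simp: homeomorphism_def intro: continuous_on_subset)
  have "inj_on g (ball 0 R)"
    using g sub by (intro inj_on_inverseI[of _ ext]) (auto simp: homeomorphism_def)
  hence "plane_domain ?W"
    unfolding plane_domain_def using cont_g \<open>0 < R\<close>
    by (intro conjI invariance_of_domain connected_continuous_image) auto
  thus ?thesis
    unfolding univalent_disk_def using \<open>0 < R\<close> gW extW inj_on_subset[OF inj_ext, of ?W] by blast
qed

end


section \<open>Coefficients of bounded harmonic functions\<close>

text \<open>\<open>|cos w|\<^sup>2 - |sin w|\<^sup>2\<close> depends on the real part of \<open>w\<close> alone: it is
  \<open>cos (2 Re w)\<close>.\<close>

lemma cmod_tan_less_1:
  assumes "\<bar>Re w\<bar> < pi / 4"
  shows "cos w \<noteq> 0" "cmod (tan w) < 1"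
proof -
  have "(cmod (cos w))\<^sup>2 - (cmod (sin w))\<^sup>2 = cos (2 * Re w)"
    unfolding norm_cos_squared norm_sin_squared exp_double cos_double_cos
    by (simp add: power2_eq_square field_simps)
  moreover have "cos (2 * Re w) > 0"
    using assms by (intro cos_gt_zero_pi) (auto simp: abs_if split: if_splits)
  ultimately have "(cmod (sin w))\<^sup>2 < (cmod (cos w))\<^sup>2"
    by simp
  hence less: "cmod (sin w) < cmod (cos w)"
    by (rule power2_less_imp_less) simp
  thus nz: "cos w \<noteq> 0"
    by auto
  show "cmod (tan w) < 1"
    using less nz by (simp add: tan_def norm_divide)
qed

text \<open>The Schwarz lemma for \<open>z \<mapsto> tan (\<pi> (K z - K 0) / (4 M))\<close>. Since \<open>K 0\<close> is purely
  imaginary, subtracting it keeps the values in the strip.\<close>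

lemma deriv_bound_strip:
  assumes hol: "K holomorphic_on ball 0 1" and "0 < M" "Re (K 0) = 0"
    and strip: "\<And>z. norm z < 1 \<Longrightarrow> \<bar>Re (K z)\<bar> < M"
  shows "cmod (deriv K 0) \<le> 4 * M / pi"
proof -
  define q where "q = pi / (4 * M)"
  have "q > 0" using \<open>0 < M\<close> by (simp add: q_def)
  define w where "w = (\<lambda>z. of_real q * (K z - K 0))"
  have w_strip: "\<bar>Re (w z)\<bar> < pi / 4" if "norm z < 1" for z
    using strip[OF that] \<open>q > 0\<close> assms(2,3) by (simp add: w_def abs_mult q_def field_simps)
  have hol_w: "w holomorphic_on ball 0 1"
    unfolding w_def by (intro holomorphic_intros hol)
  have hol_tan: "(\<lambda>z. tan (w z)) holomorphic_on ball 0 1"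
    unfolding tan_def using cmod_tan_less_1(1)[OF w_strip]
    by (intro holomorphic_intros hol_w) auto
  have "norm (deriv (\<lambda>z. tan (w z)) 0) \<le> 1"
    by (rule Schwarz_Lemma(2)[OF hol_tan, of 0]) (use cmod_tan_less_1(2)[OF w_strip] in \<open>auto simp: w_def\<close>)
  moreover have "deriv (\<lambda>z. tan (w z)) 0 = of_real q * deriv K 0"
  proof (rule DERIV_imp_deriv)
    have "(K has_field_derivative deriv K 0) (at 0)"
      by (rule holomorphic_derivI[OF hol]) auto
    thus "((\<lambda>z. tan (w z)) has_field_derivative of_real q * deriv K 0) (at 0)"
      unfolding w_def by (auto intro!: derivative_eq_intros)
  qed
  ultimately have "q * cmod (deriv K 0) \<le> 1"
    using \<open>q > 0\<close> by (simp add: norm_mult)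
  thus ?thesis
    using \<open>0 < M\<close> by (simp add: q_def field_simps)
qed

lemma sum_powers_root_of_unity:
  fixes n j :: nat
  assumes "1 \<le> n"
  shows "(\<Sum>k<n. (exp (2 * of_real pi * \<i> * of_nat k / of_nat n)) ^ j) = (if n dvd j then of_nat n else (0::complex))"
proof -
  define e where "e = exp (2 * of_real pi * \<i> * of_nat j / of_nat n :: complex)"
  have eq: "(exp (2 * of_real pi * \<i> * of_nat k / of_nat n)) ^ j = e ^ k" for k
    by (simp add: e_def field_simps flip: exp_of_nat_mult)
  have "e ^ n = exp (2 * of_real pi * \<i> * of_nat j)"
    using assms by (simp add: e_def flip: exp_of_nat_mult)
  also have "\<dots> = 1"
    by (subst exp_eq_1) (auto intro!: exI[of _ "int j"])
  finally have "e ^ n = 1" .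
  moreover have "e = 1 \<longleftrightarrow> n dvd j"
    unfolding e_def using assms by (rule complex_root_unity_eq_1)
  ultimately show ?thesis
    by (auto simp: eq sum_gp_strict)
qed

text \<open>The mean of \<open>H (\<omega> \<zeta>)\<close> over the \<open>n\<close>-th roots of unity \<open>\<omega>\<close> keeps only the
  coefficients with index divisible by \<open>n\<close>; it is therefore \<open>K (\<zeta>\<^sup>n)\<close> for an analytic
  \<open>K\<close> with values in the same strip, whose derivative at 0 is \<open>c n\<close>.\<close>

lemma coefficient_bound_strip:
  assumes sums: "\<And>z. norm z < 1 \<Longrightarrow> (\<lambda>n. c n * z ^ n) sums H z"
    and "0 < M" "Re (c 0) = 0"
    and strip: "\<And>z. norm z < 1 \<Longrightarrow> \<bar>Re (H z)\<bar> < M"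
    and n: "1 \<le> n"
  shows "cmod (c n) \<le> 4 * M / pi"
proof -
  define \<omega> where "\<omega> = (\<lambda>k. exp (2 * of_real pi * \<i> * of_nat k / of_nat n) :: complex)"
  have norm_\<omega>: "norm (\<omega> k) = 1" for k
    by (simp add: \<omega>_def)
  have sub: "(\<lambda>k. c (n * k) * (\<zeta> ^ n) ^ k) sums ((\<Sum>k<n. H (\<omega> k * \<zeta>)) / of_nat n)" if "norm \<zeta> < 1" for \<zeta>
  proof -
    have "(\<lambda>j. \<Sum>k<n. c j * (\<omega> k * \<zeta>) ^ j) sums (\<Sum>k<n. H (\<omega> k * \<zeta>))"
      using that norm_\<omega> by (intro sums_sum sums) (simp add: norm_mult)
    moreover have "(\<Sum>k<n. c j * (\<omega> k * \<zeta>) ^ j) = of_nat n * (if n dvd j then c j * \<zeta> ^ j else 0)" for j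
    proof -
      have "(\<Sum>k<n. c j * (\<omega> k * \<zeta>) ^ j) = c j * \<zeta> ^ j * (\<Sum>k<n. \<omega> k ^ j)"
        by (simp add: power_mult_distrib sum_distrib_left mult_ac)
      thus ?thesis
        unfolding \<omega>_def sum_powers_root_of_unity[OF n] by simp
    qed
    ultimately have "(\<lambda>j. of_nat n * (if n dvd j then c j * \<zeta> ^ j else 0)) sums (\<Sum>k<n. H (\<omega> k * \<zeta>))"
      by simp
    from sums_divide[OF this, of "of_nat n"]
    have *: "(\<lambda>j. if n dvd j then c j * \<zeta> ^ j else 0) sums ((\<Sum>k<n. H (\<omega> k * \<zeta>)) / of_nat n)"
      using n by simp
    have "strict_mono (\<lambda>k. n * k)" using n by (simp add: strict_mono_def)
    from sums_mono_reindex[OF this, of "\<lambda>j. if n dvd j then c j * \<zeta> ^ j else 0"] *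
    show ?thesis by (force simp: power_mult)
  qed
  define K where "K = (\<lambda>z. \<Sum>k. c (n * k) * z ^ k)"
  have K: "(\<lambda>k. c (n * k) * z ^ k) sums K z \<and> \<bar>Re (K z)\<bar> < M" if "norm z < 1" for z
  proof -
    obtain \<zeta> where \<zeta>: "z = \<zeta> ^ n"
      using exists_complex_root[of n z] n by auto
    have "norm \<zeta> < 1"
      using that n by (simp add: \<zeta> norm_power power_less_one_iff)
    note s = sub[OF this, folded \<zeta>]
    have "K z = (\<Sum>k<n. H (\<omega> k * \<zeta>)) / of_nat n"
      using s unfolding K_def by (rule sums_unique[symmetric])
    hence "\<bar>Re (K z)\<bar> = \<bar>\<Sum>k<n. Re (H (\<omega> k * \<zeta>))\<bar> / n"
      by simp
    also have "\<dots> \<le> (\<Sum>k<n. \<bar>Re (H (\<omega> k * \<zeta>))\<bar>) / n"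
      by (intro divide_right_mono sum_abs) auto
    also have "\<dots> < (\<Sum>k<n. M) / n"
      using n \<open>norm \<zeta> < 1\<close> norm_\<omega>
      by (intro divide_strict_right_mono sum_strict_mono strip) (auto simp: norm_mult lessThan_empty_iff)
    finally have "\<bar>Re (K z)\<bar> < M" using n by simp
    thus ?thesis using s by (auto simp: K_def sums_iff)
  qed
  have hol: "K holomorphic_on ball 0 1"
    by (rule power_series_holomorphic[where a = "\<lambda>k. c (n * k)"]) (use K in auto)
  have "K 0 = c 0"
    unfolding K_def using powser_zero[of "\<lambda>k. c (n * k)"] by simp
  have "DERIV K 0 :> (\<Sum>k. diffs (\<lambda>k. c (n * k)) k * 0 ^ k)"
    unfolding K_def using K[of "1/2"] by (intro termdiffs_strong[of _ "1/2"]) (auto simp: sums_iff)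
  hence "deriv K 0 = c n"
    unfolding powser_zero by (auto simp: diffs_def dest: DERIV_imp_deriv)
  thus ?thesis
    using deriv_bound_strip[OF hol \<open>0 < M\<close>] K \<open>K 0 = c 0\<close> \<open>Re (c 0) = 0\<close> by simp
qed

lemma exists_aligning_rotation:
  fixes a b :: complex
  obtains \<epsilon> where "norm \<epsilon> = 1" "cmod (\<epsilon> * a + cnj \<epsilon> * b) = cmod a + cmod b"
proof
  define \<theta> where "\<theta> = (Arg b - Arg a) / 2"
  show "norm (cis \<theta>) = 1" by simp
  have "cis \<theta> * rcis (cmod a) (Arg a) + cnj (cis \<theta>) * rcis (cmod b) (Arg b)
        = of_real (cmod a + cmod b) * cis ((Arg a + Arg b) / 2)"
  proof -
    have "cis \<theta> * cis (Arg a) = cis ((Arg a + Arg b) / 2)"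
      "cis (- \<theta>) * cis (Arg b) = cis ((Arg a + Arg b) / 2)"
      unfolding cis_mult by (simp_all add: \<theta>_def field_simps)
    thus ?thesis
      unfolding rcis_def cis_cnj mult.left_commute[of "cis _"] by (simp add: algebra_simps)
  qed
  hence "cmod (cis \<theta> * a + cnj (cis \<theta>) * b) = cmod (of_real (cmod a + cmod b) * cis ((Arg a + Arg b) / 2))"
    by (simp add: rcis_cmod_Arg)
  thus "cmod (cis \<theta> * a + cnj (cis \<theta>) * b) = cmod a + cmod b"
    by (simp only: norm_mult norm_of_real norm_cis) simp
qed

text \<open>For \<open>|\<epsilon>| = 1\<close>, the real part of \<open>\<epsilon> (h + cnj g)\<close> is that of the analytic function
  \<open>\<epsilon> h + cnj \<epsilon> g\<close>. The bound for strips applies to it, and \<open>\<epsilon>\<close> can be chosen so that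
  the moduli of the two \<open>n\<close>-th coefficients add up.\<close>

lemma harmonic_coefficient_bound:
  assumes h: "\<And>z. norm z < 1 \<Longrightarrow> (\<lambda>n. a n * z ^ n) sums h z"
    and g: "\<And>z. norm z < 1 \<Longrightarrow> (\<lambda>n. b n * z ^ n) sums g z"
    and "0 < M" and zero: "a 0 + cnj (b 0) = 0"
    and bound: "\<And>z. norm z < 1 \<Longrightarrow> norm (h z + cnj (g z)) < M"
    and n: "1 \<le> n"
  shows "cmod (a n) + cmod (b n) \<le> 4 * M / pi"
proof -
  obtain \<epsilon> where \<epsilon>: "norm \<epsilon> = 1" "cmod (\<epsilon> * a n + cnj \<epsilon> * b n) = cmod (a n) + cmod (b n)"
    by (rule exists_aligning_rotation)
  have Re_eq: "Re (\<epsilon> * x + cnj \<epsilon> * y) = Re (\<epsilon> * (x + cnj y))" for x y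
    by (simp add: algebra_simps)
  have "cmod (\<epsilon> * a n + cnj \<epsilon> * b n) \<le> 4 * M / pi"
  proof (rule coefficient_bound_strip[where c = "\<lambda>n. \<epsilon> * a n + cnj \<epsilon> * b n", OF _ \<open>0 < M\<close> _ _ n])
    fix z :: complex assume z: "norm z < 1"
    show "(\<lambda>n. (\<epsilon> * a n + cnj \<epsilon> * b n) * z ^ n) sums (\<epsilon> * h z + cnj \<epsilon> * g z)"
      using sums_add[OF sums_mult[OF h[OF z], of \<epsilon>] sums_mult[OF g[OF z], of "cnj \<epsilon>"]]
      by (simp add: algebra_simps)
    have "\<bar>Re (\<epsilon> * (h z + cnj (g z)))\<bar> \<le> norm (\<epsilon> * (h z + cnj (g z)))"
      by (rule abs_Re_le_cmod)
    also have "\<dots> < M" using bound[OF z] \<epsilon>(1) by (simp add: norm_mult)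
    finally show "\<bar>Re (\<epsilon> * h z + cnj \<epsilon> * g z)\<bar> < M"
      by (simp only: Re_eq)
  next
    show "Re (\<epsilon> * a 0 + cnj \<epsilon> * b 0) = 0"
      by (simp only: Re_eq zero) simp
  qed
  thus ?thesis using \<epsilon>(2) by simp
qed


section \<open>Harmonic maps with bounded coefficients\<close>

lemma norm_power_diff_le:
  fixes x y :: complex
  assumes "0 < r" "norm x \<le> r" "norm y \<le> r"
  shows "norm (x ^ Suc m - y ^ Suc m) \<le> real (Suc m) * r ^ m * norm (x - y)"
proof -
  define x' y' where "x' = x / of_real r" and "y' = y / of_real r"
  have xy: "x = of_real r * x'" "y = of_real r * y'" "norm x' \<le> 1" "norm y' \<le> 1"
    using assms by (auto simp: x'_def y'_def norm_divide)
  have "norm (x ^ Suc m - y ^ Suc m) = r ^ Suc m * norm (x' ^ Suc m - y' ^ Suc m)"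
    using \<open>0 < r\<close> unfolding xy(1,2) power_mult_distrib right_diff_distrib[symmetric] norm_mult norm_power
    by simp
  also have "\<dots> \<le> r ^ Suc m * (real (Suc m) * norm (x' - y'))"
    using \<open>0 < r\<close> xy by (intro mult_left_mono norm_power_diff) auto
  also have "\<dots> = real (Suc m) * r ^ m * (r * norm (x' - y'))"
    by simp
  also have "r * norm (x' - y') = norm (x - y)"
    using \<open>0 < r\<close> unfolding xy(1,2) right_diff_distrib[symmetric] norm_mult by simp
  finally show ?thesis .
qed

text \<open>Strictness comes from the strict convexity of the disk: distinct \<open>x\<close> and \<open>y\<close> have their
  midpoint in the open disk, so \<open>|x + y| < 2 r\<close>. It is what keeps the displacement strictly
  distance-decreasing at the critical radius.\<close>

lemma norm_square_diff_less:
  fixes x y :: complex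
  assumes "0 < r" "norm x \<le> r" "norm y \<le> r" "x \<noteq> y"
  shows "norm (x\<^sup>2 - y\<^sup>2) < 2 * r * norm (x - y)"
proof -
  have "(norm (x + y))\<^sup>2 = 2 * (norm x)\<^sup>2 + 2 * (norm y)\<^sup>2 - (norm (x - y))\<^sup>2"
    unfolding cmod_power2 by (simp add: power2_eq_square algebra_simps)
  also have "\<dots> < 2 * r\<^sup>2 + 2 * r\<^sup>2"
  proof -
    have "(norm x)\<^sup>2 \<le> r\<^sup>2" "(norm y)\<^sup>2 \<le> r\<^sup>2" "0 < (norm (x - y))\<^sup>2"
      using assms by (auto intro: power_mono)
    thus ?thesis by linarith
  qed
  also have "\<dots> = (2 * r)\<^sup>2" by (simp add: power2_eq_square)
  finally have "norm (x + y) < 2 * r"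
    using \<open>0 < r\<close> by (intro power2_less_imp_less[of "norm (x + y)"]) auto
  moreover have "norm (x\<^sup>2 - y\<^sup>2) = norm (x + y) * norm (x - y)"
    by (simp add: power2_eq_square square_diff_square_factored norm_mult)
  ultimately show ?thesis using \<open>x \<noteq> y\<close> by simp
qed

lemma derivative_geometric_tail:
  fixes r :: real
  assumes "0 \<le> r" "r < 1"
  shows "(\<lambda>n. real (n + 2) * r ^ (n + 1)) sums (1 / (1 - r)\<^sup>2 - 1)"
  using sums_split_initial_segment[OF geometric_deriv_sums[of r], of 1] assms by simp

locale harmonic_near_identity =
  fixes h g :: "complex \<Rightarrow> complex" and a b :: "nat \<Rightarrow> complex" and k :: real
  assumes sums_h: "\<And>z. norm z < 1 \<Longrightarrow> (\<lambda>n. a n * z ^ n) sums h z"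
    and sums_g: "\<And>z. norm z < 1 \<Longrightarrow> (\<lambda>n. b n * z ^ n) sums g z"
    and value_zero: "a 0 + cnj (b 0) = 0"
    and linear_part: "a 1 = 1" "b 1 = 0"
    and k_pos: "0 < k"
    and coefficients: "\<And>n. cmod (a (n + 2)) + cmod (b (n + 2)) \<le> k"
begin

definition displacement :: "complex \<Rightarrow> complex" where
  "displacement z = h z + cnj (g z) - z"

lemma sums_displacement:
  assumes "norm z < 1"
  shows "(\<lambda>n. a (n + 2) * z ^ (n + 2) + cnj (b (n + 2) * z ^ (n + 2))) sums displacement z"
proof -
  have "(\<lambda>n. a n * z ^ n + cnj (b n * z ^ n)) sums (h z + cnj (g z))"
    using sums_h[OF assms] sums_g[OF assms] by (intro sums_add) (simp_all only: sums_cnj)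
  from sums_split_initial_segment[OF this, of 2] show ?thesis
    using value_zero linear_part
    by (simp add: displacement_def numeral_2_eq_2 algebra_simps)
qed

lemma norm_pair_le: "norm (a (n + 2) * x + cnj (b (n + 2) * x)) \<le> k * norm x"
proof -
  have "norm (a (n + 2) * x + cnj (b (n + 2) * x)) \<le> (cmod (a (n + 2)) + cmod (b (n + 2))) * norm x"
    by (rule order_trans[OF norm_triangle_ineq]) (simp add: norm_mult algebra_simps)
  also have "\<dots> \<le> k * norm x"
    by (intro mult_right_mono coefficients) simp
  finally show ?thesis .
qed

lemma displacement_bound:
  assumes "norm z \<le> r" "r < 1"
  shows "norm (displacement z) \<le> k * (r\<^sup>2 / (1 - r))"
proof -
  have "0 \<le> r" using assms norm_ge_zero order_trans by blast
  let ?t = "\<lambda>n. a (n + 2) * z ^ (n + 2) + cnj (b (n + 2) * z ^ (n + 2))"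
  have geom: "(\<lambda>n. k * r\<^sup>2 * r ^ n) sums (k * r\<^sup>2 * (1 / (1 - r)))"
    using \<open>0 \<le> r\<close> assms by (intro sums_mult geometric_sums) auto
  have le: "norm (?t n) \<le> k * r\<^sup>2 * r ^ n" for n
  proof -
    have "norm (?t n) \<le> k * norm z ^ (n + 2)"
      using norm_pair_le[of n "z ^ (n + 2)"] by (simp only: norm_power)
    also have "\<dots> \<le> k * r ^ (n + 2)"
      using assms k_pos by (intro mult_left_mono power_mono) auto
    also have "\<dots> = k * r\<^sup>2 * r ^ n"
      by (simp add: power2_eq_square mult_ac)
    finally show ?thesis .
  qed
  have "norm (suminf ?t) \<le> (\<Sum>n. k * r\<^sup>2 * r ^ n)"
    by (intro norm_suminf_le le sums_summable[OF geom])
  moreover have "displacement z = suminf ?t"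
    using assms by (intro sums_unique sums_displacement) auto
  ultimately show ?thesis
    using sums_unique[OF geom] by simp
qed

text \<open>The power differences are estimated term by term; the quadratic term, present because
  \<open>k > 0\<close>, supplies the strict inequality.\<close>

lemma displacement_shrinks:
  assumes r: "0 < r" "r < 1" "k * (1 / (1 - r)\<^sup>2 - 1) \<le> 1"
    and xy: "norm x \<le> r" "norm y \<le> r" "x \<noteq> y"
  shows "norm (displacement x - displacement y) < norm (x - y)"
proof -
  let ?d = "\<lambda>n. x ^ (n + 2) - y ^ (n + 2)"
  let ?t = "\<lambda>n. a (n + 2) * ?d n + cnj (b (n + 2) * ?d n)"
  let ?B = "\<lambda>n. k * norm (x - y) * (real (n + 2) * r ^ (n + 1))"
  have d_le: "norm (?d n) \<le> real (n + 2) * r ^ (n + 1) * norm (x - y)" for n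
    using norm_power_diff_le[OF r(1) xy(1,2), of "n + 1"] by simp
  have le: "k * norm (?d n) \<le> ?B n" for n
    using mult_left_mono[OF d_le[of n], of k] k_pos by (simp only: mult_ac)
  have B: "?B sums (k * norm (x - y) * (1 / (1 - r)\<^sup>2 - 1))"
    using r by (intro sums_mult derivative_geometric_tail) auto
  have summ: "summable (\<lambda>n. k * norm (?d n))"
    by (rule summable_comparison_test'[OF sums_summable[OF B], of 0]) (use le k_pos in auto)
  have less0: "k * norm (?d 0) < ?B 0"
    using norm_square_diff_less[OF r(1) xy] k_pos by (simp add: mult_ac numeral_2_eq_2)
  have "0 < (\<Sum>n. ?B n - k * norm (?d n))"
  proof (rule suminf_pos2[of _ 0])
    show "summable (\<lambda>n. ?B n - k * norm (?d n))"
      by (intro summable_diff summ sums_summable[OF B])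
    show "0 \<le> ?B n - k * norm (?d n)" for n
      using le[of n] by linarith
    show "0 < ?B 0 - k * norm (?d 0)"
      using less0 by linarith
  qed
  hence "(\<Sum>n. k * norm (?d n)) < suminf ?B"
    using suminf_diff[OF sums_summable[OF B] summ] by linarith
  also have "suminf ?B = k * (1 / (1 - r)\<^sup>2 - 1) * norm (x - y)"
    using sums_unique[OF B] by (simp add: mult_ac)
  also have "\<dots> \<le> 1 * norm (x - y)"
    using r(3) by (intro mult_right_mono) auto
  finally have "(\<Sum>n. k * norm (?d n)) < norm (x - y)" by simp
  moreover have "?t sums (displacement x - displacement y)"
    using sums_diff[OF sums_displacement sums_displacement, of x y] r xy
    by (simp add: algebra_simps)
  hence "norm (displacement x - displacement y) \<le> (\<Sum>n. k * norm (?d n))"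
    using norm_suminf_le[of ?t, OF norm_pair_le summ] by (simp only: sums_iff)
  ultimately show ?thesis by simp
qed

lemma derivatives:
  assumes z: "norm z < 1"
  shows "(h has_field_derivative (\<Sum>n. diffs a n * z ^ n)) (at z)"
    and "(g has_field_derivative (\<Sum>n. diffs b n * z ^ n)) (at z)"
proof -
  obtain t where t: "norm z < t" "t < 1" using dense[OF z] by blast
  hence t0: "0 < t" using norm_ge_zero[of z] by linarith
  have *: "(f has_field_derivative (\<Sum>n. diffs c n * z ^ n)) (at z)"
    if "\<And>z. norm z < 1 \<Longrightarrow> (\<lambda>n. c n * z ^ n) sums f z" for f c
  proof -
    have "((\<lambda>w. \<Sum>n. c n * w ^ n) has_field_derivative (\<Sum>n. diffs c n * z ^ n)) (at z)"
      by (rule termdiffs_strong[of _ "of_real t"])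
         (use that[of "of_real t"] t t0 in \<open>auto simp: sums_iff\<close>)
    thus ?thesis
      by (rule has_field_derivative_transform_within_open[of _ _ _ "ball 0 1"])
         (use that z in \<open>auto simp: sums_iff\<close>)
  qed
  show "(h has_field_derivative (\<Sum>n. diffs a n * z ^ n)) (at z)"
    "(g has_field_derivative (\<Sum>n. diffs b n * z ^ n)) (at z)"
    by (rule *, rule sums_h sums_g, assumption)+
qed

text \<open>This bounds the distance of the differential of \<open>h + cnj g\<close> from the identity in operator
  norm, which is the sum of the moduli of the two Wirtinger derivatives of the displacement.\<close>

lemma derivative_bound:
  assumes z: "norm z < 1"
  shows "cmod ((\<Sum>n. diffs a n * z ^ n) - 1) + cmod (\<Sum>n. diffs b n * z ^ n)
         \<le> k * (1 / (1 - norm z)\<^sup>2 - 1)"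
proof -
  let ?B = "\<lambda>n. k * (real (n + 2) * norm z ^ (n + 1))"
  have B: "?B sums (k * (1 / (1 - norm z)\<^sup>2 - 1))"
    using z by (intro sums_mult derivative_geometric_tail) auto
  let ?A = "\<lambda>c n. cmod (c (n + 2)) * (real (n + 2) * norm z ^ (n + 1))"
  have A_le: "cmod (c (n + 2)) \<le> k \<Longrightarrow> ?A c n \<le> ?B n" for c :: "nat \<Rightarrow> complex" and n
    by (intro mult_right_mono) auto
  have summ: "summable (?A c)" if "\<And>n. cmod (c (n + 2)) \<le> k" for c :: "nat \<Rightarrow> complex"
    by (rule summable_comparison_test'[OF sums_summable[OF B], of 0]) (use A_le that in auto)
  have tail: "cmod ((\<Sum>n. diffs c n * z ^ n) - c 1) \<le> suminf (?A c)"
    if c: "\<And>n. cmod (c (n + 2)) \<le> k" for c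
  proof -
    let ?T = "\<lambda>n. diffs c (Suc n) * z ^ Suc n"
    have norm_T: "norm (?T n) = ?A c n" for n
      by (simp add: diffs_def norm_mult norm_power mult_ac del: of_nat_Suc)
    have "summable ?T"
      by (rule summable_norm_cancel) (use summ[of c, OF c] in \<open>simp only: norm_T\<close>)
    hence "summable (\<lambda>n. diffs c n * z ^ n)"
      by (subst (asm) summable_Suc_iff)
    from suminf_split_head[OF this] have "(\<Sum>n. diffs c n * z ^ n) - c 1 = suminf ?T"
      by (simp add: diffs_def)
    thus ?thesis
      using norm_suminf_le[OF eq_refl[OF norm_T] summ[of c, OF c]] by simp
  qed
  have a: "cmod (a (n + 2)) \<le> k" and b: "cmod (b (n + 2)) \<le> k" for n
    using coefficients[of n] by (smt (verit) norm_ge_zero)+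
  have "cmod ((\<Sum>n. diffs a n * z ^ n) - 1) + cmod (\<Sum>n. diffs b n * z ^ n) \<le> suminf (?A a) + suminf (?A b)"
    using tail[of a, OF a] tail[of b, OF b] linear_part by simp
  also have "\<dots> = (\<Sum>n. ?A a n + ?A b n)"
    by (intro suminf_add summ a b)
  also have "\<dots> \<le> suminf ?B"
  proof (intro suminf_le summable_add summ a b sums_summable[OF B])
    fix n show "?A a n + ?A b n \<le> ?B n"
      unfolding distrib_right[symmetric] by (intro mult_right_mono coefficients) auto
  qed
  finally show ?thesis using sums_unique[OF B] by simp
qed

end

section \<open>The close-to-convex disk and the covered disk\<close>

lemma wirtinger_harmonic:
  assumes eq: "\<And>z. norm z < 1 \<Longrightarrow> f z = h z + cnj (g z)"
    and "(h has_field_derivative h') (at z)" "(g has_field_derivative g') (at z)" "norm z < 1"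
  shows "f differentiable (at z)" "wirtinger_z f z = h'" "wirtinger_zbar f z = cnj g'"
proof -
  have "((\<lambda>z. h z + cnj (g z)) has_derivative (\<lambda>v. h' * v + cnj (g' * v))) (at z)"
    using assms(2,3)[THEN has_field_derivative_imp_has_derivative]
    by (intro has_derivative_add has_derivative_cnj)
  hence D: "(f has_derivative (\<lambda>v. h' * v + cnj (g' * v))) (at z)"
    by (rule has_derivative_transform_within_open[of _ _ _ _ "ball 0 1"]) (use assms eq in auto)
  thus "f differentiable (at z)"
    by (auto simp: differentiable_def)
  have "frechet_derivative f (at z) = (\<lambda>v. h' * v + cnj (g' * v))"
    using frechet_derivative_at[OF D] by simp
  thus "wirtinger_z f z = h'" "wirtinger_zbar f z = cnj g'"
    by (simp_all add: wirtinger_z_def wirtinger_zbar_def algebra_simps)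
qed

text \<open>The radius is the root in the unit interval of the equation that makes the Lipschitz constant
  of the displacement equal to 1. The last inequality makes the covered disk nondegenerate.\<close>

lemma landau_radius:
  fixes k r :: real
  assumes "0 < k" and r: "r = 1 - sqrt (k / (k + 1))"
  shows "0 < r" "r < 1" "k * (1 / (1 - r)\<^sup>2 - 1) = 1" "k * (r\<^sup>2 / (1 - r)) < r"
proof -
  define s where "s = sqrt (k / (k + 1))"
  have s2: "s\<^sup>2 = k / (k + 1)" using assms by (simp add: s_def)
  have s: "0 < s" "s < 1" using assms by (auto simp: s_def)
  have rs: "r = 1 - s" using r by (simp add: s_def)
  show "0 < r" "r < 1" using s rs by auto
  show "k * (1 / (1 - r)\<^sup>2 - 1) = 1"
    using assms(1) by (simp add: rs s2 field_simps)
  have "s\<^sup>2 < s" using s by (simp add: power2_eq_square)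
  hence "k < (k + 1) * s" using assms(1) by (simp add: s2 field_simps)
  hence "k * r < 1 - r" by (simp add: rs algebra_simps)
  hence "k * r * r < (1 - r) * r" using \<open>0 < r\<close> by (rule mult_strict_right_mono)
  thus "k * (r\<^sup>2 / (1 - r)) < r"
    using \<open>r < 1\<close> by (simp add: power2_eq_square field_simps)
qed

lemma univalent_disk_cong:
  assumes "\<And>z. z \<in> U \<Longrightarrow> f z = f' z" "univalent_disk f U c \<rho>"
  shows "univalent_disk f' U c \<rho>"
proof -
  obtain W where W: "W \<subseteq> U" "plane_domain W" "inj_on f W" "f ` W = ball c \<rho>" "\<rho> > 0"
    using assms(2) by (auto simp: univalent_disk_def)
  have eq: "\<And>z. z \<in> W \<Longrightarrow> f z = f' z" using assms(1) W(1) by blast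
  have "inj_on f' W" using inj_on_cong[of W f f'] eq W(3) by blast
  moreover have "f' ` W = ball c \<rho>" using image_cong[of W W f f'] eq W(4) by simp
  ultimately show ?thesis using W by (auto simp: univalent_disk_def)
qed

theorem theorem1p12:
  fixes M r\<^sub>S R\<^sub>S :: real and f :: "complex \<Rightarrow> complex"
  assumes "M > 0"
    and "f \<in> bounded_harmonic_class M"
    and "r\<^sub>S = 1 - sqrt (4 * M / (4 * M + pi))"
    and "R\<^sub>S = r\<^sub>S - 4 * M / pi * (r\<^sub>S\<^sup>2 / (1 - r\<^sub>S))"
  shows "close_to_convex_in_disk f r\<^sub>S \<and>
         (\<exists>c \<rho>. \<rho> \<ge> R\<^sub>S \<and> univalent_disk f (ball 0 r\<^sub>S) c \<rho>)"
proof -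
  define k where "k = 4 * M / pi"
  have "k > 0" using assms(1) by (simp add: k_def)
  have "4 * M / (4 * M + pi) = k / (k + 1)"
    by (simp add: k_def field_simps)
  hence "r\<^sub>S = 1 - sqrt (k / (k + 1))" using assms(3) by simp
  note radius = landau_radius[OF \<open>k > 0\<close> this]
  obtain h g where hg: "h holomorphic_on ball 0 1" "g holomorphic_on ball 0 1"
    and f_eq: "\<And>z. norm z < 1 \<Longrightarrow> f z = h z + cnj (g z)"
    and normalized: "f 0 = 0" "wirtinger_zbar f 0 = 0" "wirtinger_z f 0 = 1"
    and bound: "\<And>z. norm z < 1 \<Longrightarrow> norm (f z) < M"
    using assms(2) by (auto simp: bounded_harmonic_class_def)
  define a where "a = (\<lambda>n. (deriv ^^ n) h 0 / fact n)"
  define b where "b = (\<lambda>n. (deriv ^^ n) g 0 / fact n)"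
  have sums: "(\<lambda>n. a n * z ^ n) sums h z" "(\<lambda>n. b n * z ^ n) sums g z" if "norm z < 1" for z
    using holomorphic_power_series[OF hg(1), of z] holomorphic_power_series[OF hg(2), of z] that
    by (simp_all add: a_def b_def)
  have zero: "a 0 + cnj (b 0) = 0"
    using normalized(1) f_eq[of 0] by (simp add: a_def b_def)
  have "wirtinger_z f 0 = deriv h 0" "wirtinger_zbar f 0 = cnj (deriv g 0)"
    by (rule wirtinger_harmonic[of f h g, OF f_eq] holomorphic_derivI[OF hg(1)] holomorphic_derivI[OF hg(2)] | simp)+
  hence linear: "a 1 = 1" "b 1 = 0"
    using normalized by (auto simp: a_def b_def)
  interpret harmonic_near_identity h g a b k
  proof
    show "cmod (a (n + 2)) + cmod (b (n + 2)) \<le> k" for n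
      unfolding k_def
      by (rule harmonic_coefficient_bound[OF sums \<open>M > 0\<close> zero]) (use bound f_eq in auto)
  qed (use sums zero linear \<open>k > 0\<close> in auto)
  interpret shrinking_perturbation displacement r\<^sub>S
    using displacement_shrinks[of r\<^sub>S] radius by unfold_locales auto
  have ext_f: "ext z = f z" if "z \<in> ball 0 r\<^sub>S" for z
    using that radius by (simp add: ext_eq displacement_def f_eq)
  have "inj_on f (ball 0 r\<^sub>S)"
    using inj_on_subset[OF inj_ext, of "ball 0 r\<^sub>S"] inj_on_cong[of "ball 0 r\<^sub>S" ext f] ext_f by blast
  moreover have "close_to_convex_domain (f ` ball 0 r\<^sub>S)"
    using close_to_convex_image image_cong[of "ball 0 r\<^sub>S" _ ext f] ext_f by simp
  moreover have "sense_preserving_on f (ball 0 r\<^sub>S)"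
    unfolding sense_preserving_on_def
  proof (intro ballI conjI)
    fix z :: complex assume "z \<in> ball 0 r\<^sub>S"
    hence z: "norm z < r\<^sub>S" "norm z < 1" using radius by auto
    let ?h' = "\<Sum>n. diffs a n * z ^ n" and ?g' = "\<Sum>n. diffs b n * z ^ n"
    note w = wirtinger_harmonic[of f h g, OF f_eq derivatives[OF z(2)] z(2)]
    show "f differentiable (at z)" by (rule w(1))
    have "1 / (1 - norm z)\<^sup>2 < 1 / (1 - r\<^sub>S)\<^sup>2"
      using z radius(1,2) by (intro divide_strict_left_mono power_strict_mono) auto
    hence "k * (1 / (1 - norm z)\<^sup>2 - 1) < k * (1 / (1 - r\<^sub>S)\<^sup>2 - 1)"
      using \<open>k > 0\<close> by (intro mult_strict_left_mono) auto
    hence "cmod (?h' - 1) + cmod ?g' < 1"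
      using derivative_bound[OF z(2)] radius(3) by linarith
    moreover have "1 - cmod (?h' - 1) \<le> cmod ?h'"
      using norm_triangle_ineq2[of 1 "1 - ?h'"] by (simp add: norm_minus_commute)
    ultimately have "cmod ?g' < cmod ?h'" by linarith
    hence "(cmod ?g')\<^sup>2 < (cmod ?h')\<^sup>2" by (intro power_strict_mono) auto
    thus "(cmod (wirtinger_z f z))\<^sup>2 - (cmod (wirtinger_zbar f z))\<^sup>2 > 0"
      by (simp add: w(2,3))
  qed
  moreover have "univalent_disk f (ball 0 r\<^sub>S) 0 R\<^sub>S"
  proof (rule univalent_disk_cong[OF ext_f univalent_disk_image])
    show "0 < R\<^sub>S" using radius(4) assms(4) by (simp add: k_def)
    show "norm (displacement z) \<le> r\<^sub>S - R\<^sub>S" if "z \<in> cball 0 r\<^sub>S" for z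
      using displacement_bound[of z r\<^sub>S] that radius(2) assms(4) by (simp add: k_def)
  qed
  ultimately show ?thesis
    unfolding close_to_convex_in_disk_def by blast
qed

end
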